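(* Let $\{\mathcal{A}_k\}_{k=1}^{\infty}$ be a sequence of labyrinth patterns (with widths $m_k\ge 3$). Let $T=(TB,LR,TR,RB,BL,LT)$ be the ordered list of the six path/square types. For $x\in T$ let $\ell_k(x)$ be the length of the $x$-path in $\mathcal{G}(\mathcal{A}_k)$ for $k\ge 1$, and let $\ell^{(n)}(x)$ be the length of the $x$-path in $\mathcal{G}(\mathcal{W}_n)$ for $n\ge 1$. Then there exist $6\times 6$ matrices $M_k$, $k=1,2,\dots$, with non-negative entries and with rows and columns indexed by $T$ in the given order, such that $$\bigl(\ell_k(TB),\ell_k(LR),\ell_k(TR),\ell_k(RB),\ell_k(BL),\ell_k(LT)\bigr)^{\top}=M_k\cdot(1,1,1,1,1,1)^{\top}\quad\text{for all }k\ge 1,$$ and such that, setting $M(n)=M_1\cdot M_2\cdots M_n$ for all $n\ge 1$, the element in row $x$ and column $y$ of $M(n)$ is the number of $y$-squares in the $x$-path in $\mathcal{G}(\mathcal{W}_n)$, for all $x,y\in T$. Furthermore, for all $n\ge 1$, $$\bigl(\ell^{(n)}(TB),\ell^{(n)}(LR),\ell^{(n)}(TR),\ell^{(n)}(RB),\ell^{(n)}(BL),\ell^{(n)}(LT)\bigr)^{\top}=M(n)\cdot(1,1,1,1,1,1)^{\top}.$$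
   Context: Patterns. For an integer $m\ge 1$ let $S_{i,j,m}=\{(x,y)\mid \frac{i}{m}\le x\le \frac{i+1}{m},\ \frac{j}{m}\le y\le\frac{j+1}{m}\}$ and $\mathcal{S}_m=\{S_{i,j,m}\mid 0\le i\le m-1,\ 0\le j\le m-1\}$. A nonempty subset $\mathcal{A}\subseteq\mathcal{S}_m$ is called an $m$-pattern of width $m$; its elements are called its white squares. Graph, exits. $\mathcal{G}(\mathcal{A})$ is the graph whose vertices are the white squares of $\mathcal{A}$ and whose edges are the unordered pairs of distinct white squares having a common side. The top (bottom) row of $\mathcal{A}$ is the set of white squares $S_{i,j,m}\in\mathcal{A}$ with $j=m-1$ ($j=0$); the left (right) column is the set of those with $i=0$ ($i=m-1$). A top exit is a white square in the top row such that there is a white square in the same column in the bottom row, the latter being the corresponding bottom exit; together they form a vertical exit pair. A left exit is a white square in the left column such that there is a white square in the same row in the right column, the latter being the corresponding right exit; together they form a horizontal exit pair. Labyrinth pattern. An $m$-pattern $\mathcal{A}$ with $m\ge 3$ is a labyrinth pattern if: (1) $\mathcal{G}(\mathcal{A})$ is a tree; (2) $\mathcal{A}$ has exactly one vertical exit pair and exactly one horizontal exit pair; (3) if there is a white square in $\mathcal{A}$ at a corner of the unit square, then there is no white square in $\mathcal{A}$ at the diagonally opposite corner. Iterative construction. For a square $Q=[x,x+q]\times[y,y+q]\subseteq[0,1]^2$ put $P_Q(z_x,z_y)=(qz_x+x,\,qz_y+y)$. Given patterns $\mathcal{A}_k\subseteq\mathcal{S}_{m_k}$, let $m(n)=\prod_{k=1}^n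 m_k$, $\mathcal{W}_1=\mathcal{A}_1$ and, for $n\ge 2$, $\mathcal{W}_n=\{P_{V}(W)\mid W\in\mathcal{A}_n,\ V\in\mathcal{W}_{n-1}\}\subseteq\mathcal{S}_{m(n)}$. If all $\mathcal{A}_k$ are labyrinth patterns, then $\mathcal{W}_n$, viewed as an $m(n)$-pattern, also satisfies (1), (2), (3), so $\mathcal{G}(\mathcal{W}_n)$ is a tree and $\mathcal{W}_n$ has a unique top, bottom, left and right exit. Paths. A path in a graph is a sequence of pairwise distinct vertices, consecutive ones adjacent. The $TB$-, $LR$-, $TR$-, $RB$-, $BL$-, $LT$-path in $\mathcal{G}(\mathcal{A}_k)$ (or $\mathcal{G}(\mathcal{W}_n)$) is the unique path leading from the top to the bottom exit, from the left to the right exit, from the top to the right exit, from the right to the bottom exit, from the bottom to the left exit, and from the left to the top exit, respectively. The length of such a path is the number of squares in it. Types of squares. With respect to a given such path between two exits, each square of the path is given a type according to the positions of its two neighbours within the path: it is a $TB$-, $LR$-, $TR$-, $RB$-, $BL$-, $LT$-square if its two neighbours are at its top and bottom, left and right, top and right, right and bottom, bottom and left, left and top sides, respectively. Here the squares at the ends of the path are considered to have an additional neighbour outside the unit square, across the side corresponding to the exit (e.g. the bottom exit at the end of a path is supposed to have a neighbour below it, and similarly for the other exits). *)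

theory Defs
  imports "HOL-Analysis.Analysis"
begin

type_synonym square = "(real \<times> real) set"

text \<open>Undirected simple graphs: a vertex set together with a set of two-element edges.\<close>

type_synonym 'a graph = "'a set \<times> 'a set set"

definition is_path :: "'a graph \<Rightarrow> 'a list \<Rightarrow> bool" where
  "is_path G p \<longleftrightarrow> p \<noteq> [] \<and> distinct p \<and> set p \<subseteq> fst G \<and>
     successively (\<lambda>u v. {u, v} \<in> snd G) p"

definition path_from_to :: "'a graph \<Rightarrow> 'a \<Rightarrow> 'a \<Rightarrow> 'a list \<Rightarrow> bool" where
  "path_from_to G u v p \<longleftrightarrow> is_path G p \<and> hd p = u \<and> last p = v"

definition is_cycle :: "'a graph \<Rightarrow> 'a list \<Rightarrow> bool" where
  "is_cycle G p \<longleftrightarrow> is_path G p \<and> 3 \<le> length p \<and> {last p, hd p} \<in> snd G"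

definition is_tree :: "'a graph \<Rightarrow> bool" where
  "is_tree G \<longleftrightarrow> fst G \<noteq> {} \<and>
     (\<forall>u\<in>fst G. \<forall>v\<in>fst G. \<exists>p. path_from_to G u v p) \<and> (\<nexists>p. is_cycle G p)"

definition grid_square :: "nat \<Rightarrow> nat \<Rightarrow> nat \<Rightarrow> square" where
  "grid_square m i j =
     {real i / real m .. (real i + 1) / real m} \<times> {real j / real m .. (real j + 1) / real m}"

definition grid_squares :: "nat \<Rightarrow> square set" where
  "grid_squares m = {grid_square m i j | i j. i < m \<and> j < m}"

definition is_pattern :: "nat \<Rightarrow> square set \<Rightarrow> bool" where
  "is_pattern m A \<longleftrightarrow> 1 \<le> m \<and> A \<noteq> {} \<and> A \<subseteq> grid_squares m"

datatype side = Top | Bottom | Left | Right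

primrec side_of :: "side \<Rightarrow> square \<Rightarrow> (real \<times> real) set" where
  "side_of Top Q = {p \<in> Q. \<forall>r\<in>Q. snd r \<le> snd p}"
| "side_of Bottom Q = {p \<in> Q. \<forall>r\<in>Q. snd p \<le> snd r}"
| "side_of Left Q = {p \<in> Q. \<forall>r\<in>Q. fst p \<le> fst r}"
| "side_of Right Q = {p \<in> Q. \<forall>r\<in>Q. fst r \<le> fst p}"

text \<open>\<open>neighbour_at d Q R\<close>: the square \<open>R\<close> is different from \<open>Q\<close>, and the side \<open>d\<close> of \<open>Q\<close> is also
  a side of \<open>R\<close> (for squares of one grid, necessarily the opposite one).\<close>

definition neighbour_at :: "side \<Rightarrow> square \<Rightarrow> square \<Rightarrow> bool" where
  "neighbour_at d Q R \<longleftrightarrow> Q \<noteq> R \<and> (\<exists>e. side_of d Q = side_of e R)"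

definition pattern_graph :: "square set \<Rightarrow> square graph" where
  "pattern_graph A = (A, {{Q, R} | Q R. Q \<in> A \<and> R \<in> A \<and> (\<exists>d. neighbour_at d Q R)})"

definition vertical_exit_pairs :: "nat \<Rightarrow> square set \<Rightarrow> (square \<times> square) set" where
  "vertical_exit_pairs m A =
     {(grid_square m i (m - 1), grid_square m i 0) | i.
        i < m \<and> grid_square m i (m - 1) \<in> A \<and> grid_square m i 0 \<in> A}"

definition horizontal_exit_pairs :: "nat \<Rightarrow> square set \<Rightarrow> (square \<times> square) set" where
  "horizontal_exit_pairs m A =
     {(grid_square m 0 j, grid_square m (m - 1) j) | j.
        j < m \<and> grid_square m 0 j \<in> A \<and> grid_square m (m - 1) j \<in> A}"

primrec is_exit :: "nat \<Rightarrow> square set \<Rightarrow> side \<Rightarrow> square \<Rightarrow> bool" where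
  "is_exit m A Top Q \<longleftrightarrow> (\<exists>R. (Q, R) \<in> vertical_exit_pairs m A)"
| "is_exit m A Bottom Q \<longleftrightarrow> (\<exists>R. (R, Q) \<in> vertical_exit_pairs m A)"
| "is_exit m A Left Q \<longleftrightarrow> (\<exists>R. (Q, R) \<in> horizontal_exit_pairs m A)"
| "is_exit m A Right Q \<longleftrightarrow> (\<exists>R. (R, Q) \<in> horizontal_exit_pairs m A)"

definition labyrinth_pattern :: "nat \<Rightarrow> square set \<Rightarrow> bool" where
  "labyrinth_pattern m A \<longleftrightarrow>
     3 \<le> m \<and> is_pattern m A \<and>
     is_tree (pattern_graph A) \<and>
     (\<exists>!p. p \<in> vertical_exit_pairs m A) \<and> (\<exists>!p. p \<in> horizontal_exit_pairs m A) \<and>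
     \<not> (grid_square m 0 0 \<in> A \<and> grid_square m (m - 1) (m - 1) \<in> A) \<and>
     \<not> (grid_square m 0 (m - 1) \<in> A \<and> grid_square m (m - 1) 0 \<in> A)"

text \<open>\<open>rescale x y q\<close> is the map $P_Q$ for the square $Q = [x,x+q] \times [y,y+q]$.\<close>

definition rescale :: "real \<Rightarrow> real \<Rightarrow> real \<Rightarrow> real \<times> real \<Rightarrow> real \<times> real" where
  "rescale x y q z = (q * fst z + x, q * snd z + y)"

text \<open>Sequences of patterns are indexed from 1; the value at index 0 is only a convention, and
  the entry \<open>A 0\<close> is never used.\<close>

fun labyrinth_set :: "(nat \<Rightarrow> square set) \<Rightarrow> nat \<Rightarrow> square set" where
  "labyrinth_set A 0 = {{0..1} \<times> {0..1}}"
| "labyrinth_set A (Suc 0) = A 1"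
| "labyrinth_set A (Suc (Suc n)) =
     {rescale x y q ` W | x y q W.
        W \<in> A (Suc (Suc n)) \<and> 0 < q \<and> {x..x + q} \<times> {y..y + q} \<in> labyrinth_set A (Suc n)}"

text \<open>The six types, in the order used for the rows and columns of the matrices. The same labels
  serve for paths and for squares.\<close>

datatype path_type = TB | LR | TR | RB | BL | LT

instance path_type :: finite
proof
  have "(UNIV :: path_type set) \<subseteq> {TB, LR, TR, RB, BL, LT}"
    using path_type.exhaust by blast
  then show "finite (UNIV :: path_type set)"
    by (rule finite_subset) simp
qed

primrec start_side :: "path_type \<Rightarrow> side" where
  "start_side TB = Top"
| "start_side LR = Left"
| "start_side TR = Top"
| "start_side RB = Right"
| "start_side BL = Bottom"
| "start_side LT = Left"

primrec end_side :: "path_type \<Rightarrow> side" where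
  "end_side TB = Bottom"
| "end_side LR = Right"
| "end_side TR = Right"
| "end_side RB = Bottom"
| "end_side BL = Left"
| "end_side LT = Top"

definition exit_path :: "nat \<Rightarrow> square set \<Rightarrow> path_type \<Rightarrow> square list" where
  "exit_path m A x = (THE p. \<exists>Q R. is_exit m A (start_side x) Q \<and> is_exit m A (end_side x) R \<and>
     path_from_to (pattern_graph A) Q R p)"

definition path_length :: "nat \<Rightarrow> square set \<Rightarrow> path_type \<Rightarrow> nat" where
  "path_length m A x = length (exit_path m A x)"

text \<open>The sides at which the \<open>i\<close>-th square of the \<open>x\<close>-path \<open>p\<close> has its predecessor and its successor.
  The two end squares have their additional neighbour outside the unit square, across the side
  of the exit.\<close>

definition predecessor_at :: "path_type \<Rightarrow> square list \<Rightarrow> nat \<Rightarrow> side \<Rightarrow> bool" where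
  "predecessor_at x p i d \<longleftrightarrow>
     (if i = 0 then d = start_side x else neighbour_at d (p ! i) (p ! (i - 1)))"

definition successor_at :: "path_type \<Rightarrow> square list \<Rightarrow> nat \<Rightarrow> side \<Rightarrow> bool" where
  "successor_at x p i d \<longleftrightarrow>
     (if Suc i = length p then d = end_side x else neighbour_at d (p ! i) (p ! Suc i))"

text \<open>The type of a square does not depend on the direction in which the path traverses it.\<close>

definition squares_of_type :: "path_type \<Rightarrow> square list \<Rightarrow> path_type \<Rightarrow> square set" where
  "squares_of_type x p y = {p ! i | i. i < length p \<and>
     (\<exists>d e. predecessor_at x p i d \<and> successor_at x p i e \<and> {d, e} = {start_side y, end_side y})}"

definition count_squares :: "nat \<Rightarrow> square set \<Rightarrow> path_type \<Rightarrow> path_type \<Rightarrow> nat" where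
  "count_squares m A x y = card (squares_of_type x (exit_path m A x) y)"

text \<open>The product $M_1 \cdot M_2 \cdots M_n$.\<close>

primrec matrix_prod :: "(nat \<Rightarrow> real ^ 'n ^ 'n) \<Rightarrow> nat \<Rightarrow> real ^ 'n ^ 'n" where
  "matrix_prod M 0 = mat 1"
| "matrix_prod M (Suc n) = matrix_prod M n ** M (Suc n)"

end

theory Submission imports Defs begin

text \<open>
  Squares of the grid of width \<open>m\<close> are identified with cells \<open>(i, j)\<close>, and a path between two exits is
  recorded as an itinerary that stores with every cell the sides through which it is entered and
  left. The \<open>x\<close>-itinerary of a composite pattern arises from the \<open>x\<close>-itinerary of the outer pattern
  by replacing each passage of type \<open>z\<close> by the \<open>z\<close>-itinerary of the inner pattern (reversed if
  necessary): since the inner pattern has a unique exit pair in each direction, consecutive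
  subitineraries fit together, and the types are those of the inner passages. Counting types gives
  the matrix product.

  That this itinerary is \<^emph>\<open>the\<close> exit path rests on the fact that every edge of the composite is a
  bridge: an edge between two blocks is the only one joining them and inherits the cut of the
  outer tree, and an edge within a block inherits the cut of the inner tree, extended to every
  other block according to the exit through which that block is reached.
\<close>

section \<open>Bridges and uniqueness of paths\<close>

text \<open>Every edge is a bridge, phrased by a set \<open>S\<close> whose boundary is just that edge. In this form
  acyclicity passes to composites without manipulating cycles.\<close>

definition has_cuts :: "'a graph \<Rightarrow> bool" where
  "has_cuts G \<longleftrightarrow> (\<forall>u v. {u, v} \<in> snd G \<longrightarrow>
     (\<exists>S. u \<notin> S \<and> v \<in> S \<and> (\<forall>a b. {a, b} \<in> snd G \<longrightarrow> a \<notin> S \<longrightarrow> b \<in> S \<longrightarrow> a = u \<and> b = v)))"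

text \<open>The cut is the set of vertices reachable from \<open>v\<close> by a path avoiding
  \<open>u\<close>. An edge from \<open>a\<close> into it must start at \<open>u\<close>, since
  otherwise the path to its end could be prolonged or cut short to reach \<open>a\<close>. It must
  end at \<open>v\<close>, since a path from \<open>v\<close> to another neighbour of
  \<open>u\<close> would close up to a cycle.\<close>

lemma acyclic_has_cuts:
  assumes no_cycle: "\<nexists>p. is_cycle G p"
    and edges: "\<And>a b. {a, b} \<in> snd G \<Longrightarrow> a \<in> fst G \<and> b \<in> fst G \<and> a \<noteq> b"
  shows "has_cuts G"
  unfolding has_cuts_def
proof (intro allI impI)
  fix u v assume uv: "{u, v} \<in> snd G"
  define S where "S = {w. \<exists>p. path_from_to G v w p \<and> u \<notin> set p}"
  have "u \<notin> S"
    using last_in_set by (fastforce simp: S_def path_from_to_def is_path_def)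
  moreover have "v \<in> S"
    using edges[OF uv] unfolding S_def
    by (auto intro!: exI[of _ "[v]"] simp: path_from_to_def is_path_def)
  moreover have "a = u \<and> b = v" if ab: "{a, b} \<in> snd G" "a \<notin> S" "b \<in> S" for a b
  proof -
    obtain p where p: "is_path G p" "hd p = v" "last p = b" "u \<notin> set p"
      using ab(3) by (auto simp: S_def path_from_to_def)
    have "p \<noteq> []" using p(1) by (simp add: is_path_def)
    have a: "a = u"
    proof (rule ccontr)
      assume "a \<noteq> u"
      have "a \<in> S"
      proof (cases "a \<in> set p")
        case True
        then obtain xs ys where xs: "p = xs @ a # ys" by (meson split_list)
        have "successively (\<lambda>u v. {u, v} \<in> snd G) ((xs @ [a]) @ ys)"
          using p(1) xs by (simp add: is_path_def)
        then have "successively (\<lambda>u v. {u, v} \<in> snd G) (xs @ [a])"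
          unfolding successively_append_iff by blast
        then have "path_from_to G v a (xs @ [a])"
          using p(1,2) by (cases xs) (auto simp: xs path_from_to_def is_path_def)
        then show ?thesis using p(4) unfolding S_def xs by auto
      next
        case False
        have "path_from_to G v a (p @ [a])"
          using p False edges[OF ab(1)] ab(1) \<open>p \<noteq> []\<close>
          by (auto simp: path_from_to_def is_path_def successively_append_iff insert_commute)
        then show ?thesis using p(4) \<open>a \<noteq> u\<close> unfolding S_def by auto
      qed
      then show False using ab(2) by simp
    qed
    have "b = v"
    proof (rule ccontr)
      assume "b \<noteq> v"
      obtain w q where q: "p = w # q" using \<open>p \<noteq> []\<close> by (cases p) auto
      have "q \<noteq> []" using \<open>b \<noteq> v\<close> p q by auto
      \<comment> \<open>As \<open>b\<close> differs from \<open>v\<close>, the path \<open>p\<close>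
        has at least two vertices, which gives the length 3 that a cycle requires.\<close>
      then have "is_cycle G (u # p)"
        using p ab(1) a uv edges[OF uv] q
        by (cases q) (auto simp: is_cycle_def is_path_def insert_commute)
      then show False using no_cycle by blast
    qed
    with a show ?thesis by simp
  qed
  ultimately show "\<exists>S. u \<notin> S \<and> v \<in> S \<and> (\<forall>a b. {a, b} \<in> snd G \<longrightarrow> a \<notin> S \<longrightarrow> b \<in> S \<longrightarrow> a = u \<and> b = v)"
    by blast
qed

text \<open>A discrete intermediate value argument. The decomposition of \<open>p\<close> is kept
  because the ends of the crossing edge must be recognised as members of \<open>p\<close>.\<close>

lemma successively_enters:
  assumes "successively R p" "p \<noteq> []" "hd p \<notin> S" "last p \<in> S"
  shows "\<exists>xs a b ys. p = xs @ a # b # ys \<and> a \<notin> S \<and> b \<in> S \<and> R a b"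
  using assms
proof (induction p)
  case (Cons c p)
  show ?case
  proof (cases p)
    case Nil
    then show ?thesis using Cons.prems by simp
  next
    case p: (Cons c' p')
    show ?thesis
    proof (cases "c' \<in> S")
      case True
      then show ?thesis
        using Cons.prems p by (intro exI[of _ "[]"]) auto
    next
      case False
      then obtain xs a b ys where "p = xs @ a # b # ys \<and> a \<notin> S \<and> b \<in> S \<and> R a b"
        using Cons p by auto
      then show ?thesis by (intro exI[of _ "c # xs"]) auto
    qed
  qed
qed simp

text \<open>Take the cut of the first edge of the first path. Every edge crossing it contains
  \<open>u\<close>, and both tails avoid \<open>u\<close>; so the first tail never leaves
  \<open>S\<close>, and the second, which ends in \<open>S\<close>, must already start there. Its
  first vertex is thus reached from \<open>u\<close> across the cut, hence is \<open>hd p\<close>,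
  and induction applies to the tails.\<close>

lemma has_cuts_unique_path:
  assumes cuts: "has_cuts G"
    and "path_from_to G u v p" "path_from_to G u v q"
  shows "p = q"
  using assms(2,3)
proof (induction p arbitrary: u q)
  case Nil
  then show ?case by (simp add: path_from_to_def is_path_def)
next
  case (Cons c p)
  have [simp]: "c = u" using Cons.prems by (simp add: path_from_to_def)
  obtain q' where q: "q = u # q'"
    using Cons.prems(2) by (cases q) (auto simp: path_from_to_def is_path_def)
  show ?case
  proof (cases "p = [] \<or> q' = []")
    case True
    then show ?thesis
      using Cons.prems q last_in_set[of p] last_in_set[of q']
      by (auto simp: path_from_to_def is_path_def split: if_splits)
  next
    case False
    then have ne: "p \<noteq> []" "q' \<noteq> []" by auto
    have tails: "path_from_to G (hd p) v p" "path_from_to G (hd q') v q'"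
      using Cons.prems q ne by (auto simp: path_from_to_def is_path_def successively_Cons)
    have "u \<notin> set p" "u \<notin> set q'"
      using Cons.prems q by (auto simp: path_from_to_def is_path_def)
    have up: "{u, hd p} \<in> snd G" and uq: "{u, hd q'} \<in> snd G"
      using Cons.prems q ne by (auto simp: path_from_to_def is_path_def successively_Cons)
    obtain S where S: "u \<notin> S" "hd p \<in> S"
      "\<And>a b. {a, b} \<in> snd G \<Longrightarrow> a \<notin> S \<Longrightarrow> b \<in> S \<Longrightarrow> a = u \<and> b = hd p"
      using cuts up unfolding has_cuts_def by metis
    have "v \<in> S"
    proof (rule ccontr)
      assume "v \<notin> S"
      \<comment> \<open>Leaving \<open>S\<close> is entering its complement, so the cut property is
        applied to the reversed edge.\<close>
      then obtain a b xs ys where "p = xs @ a # b # ys" "a \<notin> - S" "b \<in> - S" "{a, b} \<in> snd G"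
        using successively_enters[of "\<lambda>u v. {u, v} \<in> snd G" p "- S"] tails(1) S(2)
        unfolding path_from_to_def is_path_def by blast
      then show False
        using S(3)[of b a] \<open>u \<notin> set p\<close> by (auto simp: insert_commute)
    qed
    have "hd q' = hd p"
    proof (rule ccontr)
      assume "hd q' \<noteq> hd p"
      then have "hd q' \<notin> S" using S(1,3) uq by blast
      then obtain a b xs ys where "q' = xs @ a # b # ys" "a \<notin> S" "b \<in> S" "{a, b} \<in> snd G"
        using successively_enters[of "\<lambda>u v. {u, v} \<in> snd G" q' S] tails(2) \<open>v \<in> S\<close>
        unfolding path_from_to_def is_path_def by blast
      then show False
        using S(3)[of a b] \<open>u \<notin> set q'\<close> by auto
    qed
    then have "p = q'" using Cons.IH[OF tails(1)] tails(2) by simp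
    then show ?thesis using q by simp
  qed
qed

section \<open>Cells of a grid\<close>

type_synonym cell = "nat \<times> nat"

primrec opp :: "side \<Rightarrow> side" where
  "opp Top = Bottom" | "opp Bottom = Top" | "opp Left = Right" | "opp Right = Left"

text \<open>The equations use \<open>Suc\<close> on the larger coordinate; with truncated
  subtraction a cell on the left or bottom border would be its own neighbour.\<close>

primrec adj :: "side \<Rightarrow> cell \<Rightarrow> cell \<Rightarrow> bool" where
  "adj Top c c' \<longleftrightarrow> fst c' = fst c \<and> snd c' = Suc (snd c)"
| "adj Bottom c c' \<longleftrightarrow> fst c' = fst c \<and> snd c = Suc (snd c')"
| "adj Left c c' \<longleftrightarrow> fst c = Suc (fst c') \<and> snd c' = snd c"
| "adj Right c c' \<longleftrightarrow> fst c' = Suc (fst c) \<and> snd c' = snd c"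

lemma opp_opp [simp]: "opp (opp d) = d"
  by (cases d) auto

lemma adj_opp: "adj d c c' \<Longrightarrow> adj (opp d) c' c"
  by (cases d) auto

lemma adj_side_unique: "adj d c c' \<Longrightarrow> adj e c c' \<Longrightarrow> d = e"
  by (cases d; cases e) auto

lemma adj_cell_unique: "adj d c c' \<Longrightarrow> adj d c c'' \<Longrightarrow> c' = c''"
  by (cases d) (auto simp: prod_eq_iff)

lemma adj_neq: "adj d c c' \<Longrightarrow> c \<noteq> c'"
  by (cases d) auto

definition sq :: "nat \<Rightarrow> cell \<Rightarrow> square" where
  "sq m c = grid_square m (fst c) (snd c)"

lemma sq_box:
  "sq m c = {real (fst c) / real m .. real (Suc (fst c)) / real m} \<times>
     {real (snd c) / real m .. real (Suc (snd c)) / real m}"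
  by (simp add: sq_def grid_square_def add.commute)

lemma grid_line_eq_iff: "0 < m \<Longrightarrow> real a / real m = real b / real m \<longleftrightarrow> a = b"
  by simp

lemma grid_line_le_iff: "0 < m \<Longrightarrow> real a / real m \<le> real b / real m \<longleftrightarrow> a \<le> b"
  by (simp add: divide_le_cancel)

lemmas grid_line_iffs = grid_line_eq_iff grid_line_le_iff

lemma sq_eq_iff: "0 < m \<Longrightarrow> sq m c = sq m c' \<longleftrightarrow> c = c'"
  by (auto simp: sq_box times_eq_iff Icc_eq_Icc prod_eq_iff grid_line_iffs simp del: of_nat_Suc)

lemma inj_sq: "0 < m \<Longrightarrow> inj (sq m)"
  by (simp add: inj_def sq_eq_iff)

lemma side_of_box:
  assumes "(a::real) \<le> b" "c \<le> d"
  shows "side_of Top ({a..b} \<times> {c..d}) = {a..b} \<times> {d..d}"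
    "side_of Bottom ({a..b} \<times> {c..d}) = {a..b} \<times> {c..c}"
    "side_of Left ({a..b} \<times> {c..d}) = {a..a} \<times> {c..d}"
    "side_of Right ({a..b} \<times> {c..d}) = {b..b} \<times> {c..d}"
  using assms by (auto intro: order.antisym)

text \<open>Sides are products of intervals between grid lines, so equality of sides becomes
  equality of indices. A horizontal and a vertical side never agree, and equal sides of the same
  name force equal squares, so only opposite sides remain.\<close>

lemma neighbour_at_sq:
  assumes "0 < m"
  shows "neighbour_at d (sq m c) (sq m c') \<longleftrightarrow> adj d c c'"
proof -
  have ex: "(\<exists>e. P e) \<longleftrightarrow> P Top \<or> P Bottom \<or> P Left \<or> P Right" for P
    by (metis side.exhaust)
  have sides: "side_of Top (sq m c) = {real (fst c) / real m .. real (Suc (fst c)) / real m} \<times>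
        {real (Suc (snd c)) / real m .. real (Suc (snd c)) / real m}"
      "side_of Bottom (sq m c) = {real (fst c) / real m .. real (Suc (fst c)) / real m} \<times>
        {real (snd c) / real m .. real (snd c) / real m}"
      "side_of Left (sq m c) = {real (fst c) / real m .. real (fst c) / real m} \<times>
        {real (snd c) / real m .. real (Suc (snd c)) / real m}"
      "side_of Right (sq m c) = {real (Suc (fst c)) / real m .. real (Suc (fst c)) / real m} \<times>
        {real (snd c) / real m .. real (Suc (snd c)) / real m}" for c
    unfolding sq_box
    by (rule side_of_box; use assms in \<open>simp only: grid_line_le_iff le_Suc_eq\<close>; simp)+
  show ?thesis
    unfolding neighbour_at_def sq_eq_iff[OF assms] ex
    by (cases d)
       (use assms in \<open>auto simp: sides times_eq_iff Icc_eq_Icc grid_line_iffs prod_eq_iff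
          simp del: of_nat_Suc side_of.simps\<close>)
qed

section \<open>Graphs of cells and graphs of squares\<close>

definition cell_graph :: "cell set \<Rightarrow> cell graph" where
  "cell_graph C = (C, {{u, v} | u v. u \<in> C \<and> v \<in> C \<and> (\<exists>d. adj d u v)})"

lemma fst_cell_graph [simp]: "fst (cell_graph C) = C"
  by (simp add: cell_graph_def)

lemma symmetric_edge_iff:
  assumes "\<And>u v. R u v \<Longrightarrow> R v u"
  shows "{a, b} \<in> {{u, v} | u v. u \<in> V \<and> v \<in> V \<and> R u v} \<longleftrightarrow> a \<in> V \<and> b \<in> V \<and> R a b"
  using assms by (auto simp: doubleton_eq_iff)

lemma cell_graph_edge_iff:
  "{u, v} \<in> snd (cell_graph C) \<longleftrightarrow> u \<in> C \<and> v \<in> C \<and> (\<exists>d. adj d u v)"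
  unfolding cell_graph_def snd_conv by (rule symmetric_edge_iff) (blast dest: adj_opp)

lemma fst_pattern_graph [simp]: "fst (pattern_graph A) = A"
  by (simp add: pattern_graph_def)

lemma pattern_graph_edge_iff:
  "{Q, R} \<in> snd (pattern_graph A) \<longleftrightarrow> Q \<in> A \<and> R \<in> A \<and> (\<exists>d. neighbour_at d Q R)"
  unfolding pattern_graph_def snd_conv
  by (rule symmetric_edge_iff) (metis neighbour_at_def)

lemma pattern_graph_edge_sq:
  assumes "0 < m"
  shows "{sq m u, sq m v} \<in> snd (pattern_graph (sq m ` C)) \<longleftrightarrow> {u, v} \<in> snd (cell_graph C)"
  using inj_image_mem_iff[OF inj_sq[OF assms]]
  by (simp add: pattern_graph_edge_iff cell_graph_edge_iff neighbour_at_sq[OF assms])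

lemma is_path_sq:
  assumes "0 < m"
  shows "is_path (pattern_graph (sq m ` C)) (map (sq m) p) \<longleftrightarrow> is_path (cell_graph C) p"
  using inj_image_subset_iff[OF inj_sq[OF assms]] inj_sq[OF assms]
  by (auto simp add: is_path_def distinct_map successively_map pattern_graph_edge_sq[OF assms]
      intro: inj_on_subset)

text \<open>All vertices of a path in the square graph are images of cells, so the whole path lifts.
  Both directions matter: existence of paths is carried from squares to cells, and uniqueness back
  from cells to squares.\<close>

lemma path_from_to_sq:
  assumes "0 < m"
  shows "path_from_to (pattern_graph (sq m ` C)) (sq m u) (sq m v) q \<longleftrightarrow>
    (\<exists>p. q = map (sq m) p \<and> path_from_to (cell_graph C) u v p)" (is "?L \<longleftrightarrow> ?R")
proof
  assume q: ?L
  then have "set q \<subseteq> sq m ` C"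
    by (simp add: path_from_to_def is_path_def)
  then have "q \<in> lists (range (sq m))" by auto
  then obtain p where "q = map (sq m) p"
    unfolding lists_image by auto
  moreover have "p \<noteq> []" using q calculation by (auto simp: path_from_to_def is_path_def)
  ultimately show ?R
    using q by (auto simp: path_from_to_def is_path_sq[OF assms] hd_map last_map sq_eq_iff[OF assms])
next
  assume ?R
  then show ?L
    by (auto simp: path_from_to_def is_path_sq[OF assms] hd_map last_map is_path_def[of "cell_graph C"])
qed

text \<open>A cut among squares is pulled back along \<open>sq m\<close>, whose injectivity
  identifies the crossing edge.\<close>

lemma has_cuts_cell_graph:
  assumes "0 < m" and "is_tree (pattern_graph (sq m ` C))"
  shows "has_cuts (cell_graph C)"
proof -
  have "has_cuts (pattern_graph (sq m ` C))"
    using assms(2)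
    by (intro acyclic_has_cuts) (auto simp: is_tree_def pattern_graph_edge_iff neighbour_at_def)
  note cuts = this[unfolded has_cuts_def, rule_format]
  show ?thesis
    unfolding has_cuts_def
  proof (intro allI impI)
    fix u v assume "{u, v} \<in> snd (cell_graph C)"
    then have "{sq m u, sq m v} \<in> snd (pattern_graph (sq m ` C))"
      by (simp add: pattern_graph_edge_sq[OF assms(1)])
    from cuts[OF this] obtain S where S: "sq m u \<notin> S" "sq m v \<in> S" and
      cut: "\<And>a b. {a, b} \<in> snd (pattern_graph (sq m ` C)) \<Longrightarrow> a \<notin> S \<Longrightarrow> b \<in> S \<Longrightarrow> a = sq m u \<and> b = sq m v"
      by blast
    have "a = u \<and> b = v" if "{a, b} \<in> snd (cell_graph C)" "a \<notin> sq m -` S" "b \<in> sq m -` S" for a b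
      using cut[of "sq m a" "sq m b"] that
      by (simp add: pattern_graph_edge_sq[OF assms(1)] sq_eq_iff[OF assms(1)])
    then show "\<exists>S. u \<notin> S \<and> v \<in> S \<and>
        (\<forall>a b. {a, b} \<in> snd (cell_graph C) \<longrightarrow> a \<notin> S \<longrightarrow> b \<in> S \<longrightarrow> a = u \<and> b = v)"
      using S by (intro exI[of _ "sq m -` S"]) auto
  qed
qed

section \<open>Itineraries\<close>

text \<open>The side of entry, the cell, and the side of exit.\<close>

type_synonym passage = "side \<times> cell \<times> side"

abbreviation entry_side :: "passage \<Rightarrow> side" where "entry_side s \<equiv> fst s"
abbreviation passed_cell :: "passage \<Rightarrow> cell" where "passed_cell s \<equiv> fst (snd s)"
abbreviation exit_side :: "passage \<Rightarrow> side" where "exit_side s \<equiv> snd (snd s)"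

definition follows :: "passage \<Rightarrow> passage \<Rightarrow> bool" where
  "follows s s' \<longleftrightarrow> adj (exit_side s) (passed_cell s) (passed_cell s') \<and>
     entry_side s' = opp (exit_side s)"

text \<open>The conditions on the first entry side and the last exit side encode the additional
  neighbours outside the unit square. Distinct entry and exit sides ensure that every passage has
  exactly one of the six types.\<close>

definition itinerary :: "cell set \<Rightarrow> (side \<Rightarrow> cell) \<Rightarrow> side \<Rightarrow> side \<Rightarrow> passage list \<Rightarrow> bool" where
  "itinerary C ex d e t \<longleftrightarrow> t \<noteq> [] \<and> distinct (map passed_cell t) \<and> passed_cell ` set t \<subseteq> C \<and>
     successively follows t \<and> (\<forall>s\<in>set t. entry_side s \<noteq> exit_side s) \<and>
     entry_side (hd t) = d \<and> exit_side (last t) = e \<and>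
     passed_cell (hd t) = ex d \<and> passed_cell (last t) = ex e"

text \<open>Adjacency determines the sides between consecutive cells. A cell cannot be left through
  its entry side, because that side leads back to a cell not on the rest of the path. The hypotheses
  on \<open>hd p\<close> and \<open>last p\<close> say the same of the outside neighbours, and in
  the induction the removed first cell takes over this role.\<close>

lemma itinerary_of_path:
  assumes "p \<noteq> []" "distinct p" "successively (\<lambda>u v. \<exists>d. adj d u v) p"
    and "\<And>c. c \<in> set p \<Longrightarrow> \<not> adj d (hd p) c" "\<And>c. c \<in> set p \<Longrightarrow> \<not> adj e (last p) c"
    and "length p = 1 \<Longrightarrow> d \<noteq> e"
  shows "\<exists>t. map passed_cell t = p \<and> successively follows t \<and>
    (\<forall>s\<in>set t. entry_side s \<noteq> exit_side s) \<and> entry_side (hd t) = d \<and> exit_side (last t) = e"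
  using assms
proof (induction p arbitrary: d)
  case (Cons u p)
  show ?case
  proof (cases p)
    case Nil
    then show ?thesis using Cons.prems by (intro exI[of _ "[(d, u, e)]"]) auto
  next
    case p: (Cons w p')
    obtain f where f: "adj f u w" using Cons.prems(3) p by auto
    \<comment> \<open>Across \<open>opp f\<close> the cell \<open>w\<close> meets only
      \<open>u\<close>, which distinctness excludes from \<open>p\<close>; this is the hypothesis on
      the head needed for the tail.\<close>
    have return: "c = u" if "adj (opp f) w c" for c
      using adj_cell_unique[OF that adj_opp[OF f]] .
    have "\<exists>t. map passed_cell t = p \<and> successively follows t \<and>
      (\<forall>s\<in>set t. entry_side s \<noteq> exit_side s) \<and> entry_side (hd t) = opp f \<and> exit_side (last t) = e"
    proof (rule Cons.IH)
      \<comment> \<open>If \<open>w\<close> is also the last cell and \<open>e\<close> were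
        \<open>opp f\<close>, then \<open>u\<close> would lie across the end side, against the
        hypothesis on \<open>last p\<close>.\<close>
      show "opp f \<noteq> e" if "length p = 1"
        using that p Cons.prems(5)[of u] adj_opp[OF f] by auto
    qed (use Cons.prems p return in auto)
    then obtain t where t: "map passed_cell t = p" "successively follows t"
      "\<forall>s\<in>set t. entry_side s \<noteq> exit_side s" "entry_side (hd t) = opp f" "exit_side (last t) = e"
      by blast
    have "t \<noteq> []" using t(1) p by auto
    then have "passed_cell (hd t) = w" using t(1) p by (cases t) auto
    moreover have "d \<noteq> f" using Cons.prems(4)[of w] f p by auto
    ultimately show ?thesis
      using t f \<open>t \<noteq> []\<close>
      by (intro exI[of _ "(d, u, f) # t"]) (auto simp: successively_Cons follows_def)
  qed
qed simp

text \<open>A \<open>path_type\<close> fixes one direction between its two sides, but an outer path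
  may pass through a block in the other one.\<close>

definition reverse_itinerary :: "passage list \<Rightarrow> passage list" where
  "reverse_itinerary t = rev (map (\<lambda>(d, c, e). (e, c, d)) t)"

lemma itinerary_reverse:
  assumes "itinerary C ex d e t"
  shows "itinerary C ex e d (reverse_itinerary t)"
proof -
  have "map passed_cell (reverse_itinerary t) = rev (map passed_cell t)"
    by (simp add: reverse_itinerary_def rev_map comp_def case_prod_unfold)
  moreover have "successively follows (reverse_itinerary t)"
    using assms unfolding itinerary_def reverse_itinerary_def successively_rev successively_map
    by (auto elim!: successively_mono simp: follows_def case_prod_unfold dest: adj_opp)
  ultimately show ?thesis
    using assms unfolding itinerary_def
    by (auto simp: reverse_itinerary_def hd_rev last_rev hd_map last_map image_def case_prod_unfold)
qed

section \<open>Types of passages and their numbers\<close>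

definition has_type :: "path_type \<Rightarrow> passage \<Rightarrow> bool" where
  "has_type y s \<longleftrightarrow> {entry_side s, exit_side s} = {start_side y, end_side y}"

definition count_type :: "path_type \<Rightarrow> passage list \<Rightarrow> nat" where
  "count_type y t = length (filter (has_type y) t)"

lemma count_type_reverse [simp]: "count_type y (reverse_itinerary t) = count_type y t"
proof -
  have "has_type y \<circ> (\<lambda>(d, c, e). (e, c, d)) = has_type y"
    by (auto simp: has_type_def insert_commute)
  then show ?thesis
    by (simp add: count_type_def reverse_itinerary_def rev_filter[symmetric] filter_map)
qed

text \<open>The six types are exactly the two-element subsets of the four sides.\<close>

lemma path_type_of_sides:
  assumes "d \<noteq> e"
  shows "\<exists>y. d = start_side y \<and> e = end_side y \<or> d = end_side y \<and> e = start_side y"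
proof -
  have ex: "(\<exists>y. P y) \<longleftrightarrow> P TB \<or> P LR \<or> P TR \<or> P RB \<or> P BL \<or> P LT" for P
    by (metis path_type.exhaust)
  show ?thesis
    unfolding ex using assms by (cases d; cases e) simp_all
qed

lemma start_side_neq_end_side: "start_side y \<noteq> end_side y"
  by (cases y) auto

lemma path_type_eqI:
  "{start_side y, end_side y} = {start_side z, end_side z} \<Longrightarrow> y = z"
  unfolding doubleton_eq_iff by (cases y; cases z) simp_all

lemma has_type_iff:
  assumes "entry_side s \<noteq> exit_side s"
  shows "\<exists>z. \<forall>y. has_type y s \<longleftrightarrow> y = z"
proof -
  obtain z where z: "{entry_side s, exit_side s} = {start_side z, end_side z}"
    using path_type_of_sides[OF assms] by (auto simp: insert_commute)
  have "has_type y s \<longleftrightarrow> y = z" for y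
    unfolding has_type_def z using path_type_eqI[of z y] by blast
  then show ?thesis by blast
qed

lemma sum_count_type:
  assumes "\<forall>s\<in>set t. entry_side s \<noteq> exit_side s"
  shows "(\<Sum>y\<in>UNIV. count_type y t) = length t"
  using assms
proof (induction t)
  case (Cons s t)
  obtain z where z: "\<And>y. has_type y s \<longleftrightarrow> y = z"
    using has_type_iff[of s] Cons.prems by auto
  have "count_type y (s # t) = (if y = z then 1 else 0) + count_type y t" for y
    by (simp add: count_type_def z)
  then show ?case using Cons by (simp add: sum.distrib)
qed (simp add: count_type_def)

text \<open>The sides stored in a passage are the only predecessor and successor sides: inside the
  path because adjacency determines the side, at its ends by the boundary conditions of
  \<open>itinerary\<close>. Since the cells are distinct, counting squares and counting passages
  agree.\<close>

lemma squares_of_type_itinerary: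
  assumes "0 < m" and t: "itinerary C ex (start_side x) (end_side x) t"
  shows "card (squares_of_type x (map (sq m \<circ> passed_cell) t) y) = count_type y t"
proof -
  define p where "p = map (sq m \<circ> passed_cell) t"
  have t': "t \<noteq> []" "distinct (map passed_cell t)" "successively follows t"
    "entry_side (hd t) = start_side x" "exit_side (last t) = end_side x"
    using t by (auto simp: itinerary_def)
  have fol: "follows (t ! i) (t ! Suc i)" if "Suc i < length t" for i
    using t'(3) that by (simp add: successively_conv_nth)
  have pre: "predecessor_at x p i d \<longleftrightarrow> d = entry_side (t ! i)" if i: "i < length t" for i d
  proof (cases i)
    case 0
    then show ?thesis using t' by (simp add: predecessor_at_def hd_conv_nth)
  next
    case (Suc j)
    have "adj (entry_side (t ! i)) (passed_cell (t ! i)) (passed_cell (t ! j))"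
      using fol[of j] i Suc by (auto simp: follows_def dest: adj_opp)
    then show ?thesis
      using i Suc adj_side_unique[of d "passed_cell (t ! i)" "passed_cell (t ! j)"]
      by (auto simp: predecessor_at_def p_def neighbour_at_sq[OF assms(1)])
  qed
  have suc: "successor_at x p i e \<longleftrightarrow> e = exit_side (t ! i)" if i: "i < length t" for i e
  proof (cases "Suc i = length t")
    case True
    then have "t ! i = last t" using t'(1) by (metis diff_Suc_1 last_conv_nth)
    then show ?thesis using t' True by (simp add: successor_at_def p_def)
  next
    case False
    then show ?thesis
      using fol[of i] i adj_side_unique[of e "passed_cell (t ! i)" "passed_cell (t ! Suc i)"]
      by (auto simp: successor_at_def p_def neighbour_at_sq[OF assms(1)] follows_def)
  qed
  have "squares_of_type x p y = {p ! i | i. i < length t \<and> has_type y (t ! i)}"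
  proof -
    have "(\<exists>d e. predecessor_at x p i d \<and> successor_at x p i e \<and> {d, e} = {start_side y, end_side y})
        \<longleftrightarrow> has_type y (t ! i)" if "i < length t" for i
      unfolding has_type_def pre[OF that] suc[OF that] by blast
    moreover have "length p = length t" by (simp add: p_def)
    ultimately show ?thesis
      unfolding squares_of_type_def by (simp only: cong: conj_cong)
  qed
  also have "\<dots> = (sq m \<circ> passed_cell) ` set (filter (has_type y) t)"
  proof -
    let ?I = "{i. i < length t \<and> has_type y (t ! i)}"
    have "set (filter (has_type y) t) = (!) t ` ?I"
      unfolding set_filter set_eq_iff mem_Collect_eq image_iff in_set_conv_nth by blast
    moreover have "(!) p ` ?I = (\<lambda>i. (sq m \<circ> passed_cell) (t ! i)) ` ?I"
      by (rule image_cong) (simp_all add: p_def)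
    ultimately show ?thesis
      by (simp only: setcompr_eq_image image_image)
  qed
  also have "card \<dots> = length (filter (has_type y) t)"
  proof -
    have "distinct p"
      using t'(2) inj_sq[OF assms(1)]
      unfolding p_def by (simp add: distinct_map comp_inj_on inj_on_subset)
    then have "distinct (map (sq m \<circ> passed_cell) (filter (has_type y) t))"
      unfolding p_def by (rule distinct_map_filter)
    from distinct_card[OF this] show ?thesis by simp
  qed
  finally show ?thesis by (simp add: p_def count_type_def)
qed

section \<open>Labyrinths of cells\<close>

text \<open>\<open>facing k d c c'\<close>: if copies of the grid of width \<open>k\<close> are placed side by side, the cell \<open>c\<close>
  meets across its side \<open>d\<close> the cell \<open>c'\<close> of the adjacent copy.\<close>

primrec facing :: "nat \<Rightarrow> side \<Rightarrow> cell \<Rightarrow> cell \<Rightarrow> bool" where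
  "facing k Top c c' \<longleftrightarrow> fst c = fst c' \<and> Suc (snd c) = k \<and> snd c' = 0"
| "facing k Bottom c c' \<longleftrightarrow> fst c = fst c' \<and> snd c = 0 \<and> Suc (snd c') = k"
| "facing k Left c c' \<longleftrightarrow> snd c = snd c' \<and> fst c = 0 \<and> Suc (fst c') = k"
| "facing k Right c c' \<longleftrightarrow> snd c = snd c' \<and> Suc (fst c) = k \<and> fst c' = 0"

lemma facing_opp: "facing k (opp d) c c' \<longleftrightarrow> facing k d c' c"
  by (cases d) auto

lemma facing_not_adj:
  "facing k d c c' \<Longrightarrow> c'' \<in> {..<k} \<times> {..<k} \<Longrightarrow> \<not> adj d c c''"
  by (cases d) auto

lemma vertical_exit_pairs_sq:
  assumes "0 < k" "C \<subseteq> {..<k} \<times> {..<k}"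
  shows "vertical_exit_pairs k (sq k ` C) =
    {(sq k c, sq k c') | c c'. c \<in> C \<and> c' \<in> C \<and> facing k Top c c'}"
proof -
  have mem: "grid_square k i j \<in> sq k ` C \<longleftrightarrow> (i, j) \<in> C" for i j
    using inj_image_mem_iff[OF inj_sq[OF assms(1)], of "(i, j)"] by (simp add: sq_def)
  have "(i < k \<and> (i, k - 1) \<in> C \<and> (i, 0) \<in> C) \<longleftrightarrow> ((i, k - 1) \<in> C \<and> (i, 0) \<in> C)" for i
    using assms(2) by auto
  then show ?thesis
    using assms(1) unfolding vertical_exit_pairs_def mem sq_def
    by (intro set_eqI) (auto 0 4)
qed

lemma horizontal_exit_pairs_sq:
  assumes "0 < k" "C \<subseteq> {..<k} \<times> {..<k}"
  shows "horizontal_exit_pairs k (sq k ` C) =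
    {(sq k c, sq k c') | c c'. c \<in> C \<and> c' \<in> C \<and> facing k Left c c'}"
proof -
  have mem: "grid_square k i j \<in> sq k ` C \<longleftrightarrow> (i, j) \<in> C" for i j
    using inj_image_mem_iff[OF inj_sq[OF assms(1)], of "(i, j)"] by (simp add: sq_def)
  have "(i < k \<and> (0, i) \<in> C \<and> (k - 1, i) \<in> C) \<longleftrightarrow> ((0, i) \<in> C \<and> (k - 1, i) \<in> C)" for i
    using assms(2) by auto
  then show ?thesis
    using assms(1) unfolding horizontal_exit_pairs_def mem sq_def
    by (intro set_eqI) (auto 0 4)
qed

text \<open>The invariant preserved by composition. Itineraries give existence of the exit paths and
  \<open>cuts\<close> gives their uniqueness; phrasing \<open>exits\<close> by \<open>facing\<close>
  treats horizontal and vertical exit pairs alike.\<close>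

locale cell_labyrinth =
  fixes k :: nat and C :: "cell set" and ex :: "side \<Rightarrow> cell"
  assumes width_pos: "0 < k"
    and cells: "C \<subseteq> {..<k} \<times> {..<k}"
    and exits: "c \<in> C \<and> c' \<in> C \<and> facing k d c c' \<longleftrightarrow> c = ex d \<and> c' = ex (opp d)"
    and cuts: "has_cuts (cell_graph C)"
    and itinerary_ex: "\<exists>t. itinerary C ex (start_side x) (end_side x) t"
begin

lemma ex_in [simp]: "ex d \<in> C"
  using exits by blast

lemma ex_facing: "facing k d (ex d) (ex (opp d))"
  using exits by blast

lemma is_exit_sq: "is_exit k (sq k ` C) d Q \<longleftrightarrow> Q = sq k (ex d)"
proof -
  have "vertical_exit_pairs k (sq k ` C) = {(sq k (ex Top), sq k (ex Bottom))}"
    unfolding vertical_exit_pairs_sq[OF width_pos cells] exits opp.simps by blast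
  moreover have "horizontal_exit_pairs k (sq k ` C) = {(sq k (ex Left), sq k (ex Right))}"
    unfolding horizontal_exit_pairs_sq[OF width_pos cells] exits opp.simps by blast
  ultimately show ?thesis by (cases d) simp_all
qed

lemma exit_path_itinerary:
  assumes t: "itinerary C ex (start_side x) (end_side x) t"
  shows "exit_path k (sq k ` C) x = map (sq k \<circ> passed_cell) t"
proof -
  let ?p = "map passed_cell t"
  have "successively (\<lambda>u v. {u, v} \<in> snd (cell_graph C)) ?p"
    unfolding successively_map
  proof (rule successively_mono)
    show "successively follows t" using t by (simp add: itinerary_def)
    show "{passed_cell s, passed_cell s'} \<in> snd (cell_graph C)"
      if "s \<in> set t" "s' \<in> set t" "follows s s'" for s s'
      using t that unfolding cell_graph_edge_iff itinerary_def follows_def by blast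
  qed
  then have p: "path_from_to (cell_graph C) (ex (start_side x)) (ex (end_side x)) ?p"
    using t by (auto simp: itinerary_def path_from_to_def is_path_def hd_map last_map)
  have "path_from_to (pattern_graph (sq k ` C)) (sq k (ex (start_side x))) (sq k (ex (end_side x))) q
      \<longleftrightarrow> q = map (sq k) ?p" for q
    unfolding path_from_to_sq[OF width_pos] using p has_cuts_unique_path[OF cuts p] by blast
  then show ?thesis
    unfolding exit_path_def is_exit_sq by simp
qed

lemma count_squares_itinerary:
  assumes "itinerary C ex (start_side x) (end_side x) t"
  shows "count_squares k (sq k ` C) x y = count_type y t"
  unfolding count_squares_def exit_path_itinerary[OF assms]
  by (rule squares_of_type_itinerary[OF width_pos assms])

lemma path_length_eq_sum:
  "path_length k (sq k ` C) x = (\<Sum>y\<in>UNIV. count_squares k (sq k ` C) x y)"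
proof -
  obtain t where t: "itinerary C ex (start_side x) (end_side x) t"
    using itinerary_ex by blast
  then have "(\<Sum>y\<in>UNIV. count_type y t) = length t"
    by (intro sum_count_type) (simp add: itinerary_def)
  then show ?thesis
    by (simp add: path_length_def exit_path_itinerary[OF t] count_squares_itinerary[OF t])
qed

text \<open>Supplies a subitinerary for either direction of traversal, with counts depending only on
  the unordered pair of sides.\<close>

lemma itinerary_between:
  assumes "d \<noteq> e"
  shows "\<exists>t. itinerary C ex d e t \<and> (\<forall>x y. {d, e} = {start_side x, end_side x} \<longrightarrow>
    count_type y t = count_squares k (sq k ` C) x y)"
proof -
  obtain z where z: "d = start_side z \<and> e = end_side z \<or> d = end_side z \<and> e = start_side z"
    using path_type_of_sides[OF assms] by blast
  then have eq: "x = z" if "{d, e} = {start_side x, end_side x}" for x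
    using that by (intro path_type_eqI) (auto simp: insert_commute)
  obtain t where t: "itinerary C ex (start_side z) (end_side z) t"
    using itinerary_ex by blast
  have count: "count_type y t = count_squares k (sq k ` C) x y"
    if "{d, e} = {start_side x, end_side x}" for x y
    unfolding eq[OF that] by (rule count_squares_itinerary[OF t, symmetric])
  show ?thesis
    using z
  proof
    assume "d = start_side z \<and> e = end_side z"
    with t count show ?thesis by (intro exI[of _ t]) simp
  next
    assume "d = end_side z \<and> e = start_side z"
    with itinerary_reverse[OF t] count show ?thesis
      by (intro exI[of _ "reverse_itinerary t"]) simp
  qed
qed

end

lemma labyrinth_pattern_cells:
  assumes "labyrinth_pattern k A"
  obtains C ex where "A = sq k ` C" "cell_labyrinth k C ex"
proof -
  have k: "0 < k" using assms by (simp add: labyrinth_pattern_def)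
  define C where "C = {c \<in> {..<k} \<times> {..<k}. sq k c \<in> A}"
  have cells: "C \<subseteq> {..<k} \<times> {..<k}" by (auto simp: C_def)
  have "A \<subseteq> grid_squares k" using assms by (simp add: labyrinth_pattern_def is_pattern_def)
  moreover have "grid_squares k = sq k ` ({..<k} \<times> {..<k})"
    by (auto simp: grid_squares_def sq_def image_def)
  ultimately have "\<exists>c\<in>{..<k} \<times> {..<k}. Q = sq k c" if "Q \<in> A" for Q
    using that by (metis image_iff subsetD)
  then have A: "A = sq k ` C"
    unfolding C_def by (intro equalityI subsetI) (blast, blast)
  have tree: "is_tree (pattern_graph (sq k ` C))"
    and "\<exists>!p. p \<in> vertical_exit_pairs k (sq k ` C)" "\<exists>!p. p \<in> horizontal_exit_pairs k (sq k ` C)"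
    using assms A by (auto simp: labyrinth_pattern_def)
  then have vert: "\<exists>!p. p \<in> {(sq k c, sq k c') | c c'. c \<in> C \<and> c' \<in> C \<and> facing k Top c c'}"
    and hor: "\<exists>!p. p \<in> {(sq k c, sq k c') | c c'. c \<in> C \<and> c' \<in> C \<and> facing k Left c c'}"
    by (simp_all only: vertical_exit_pairs_sq[OF k cells] horizontal_exit_pairs_sq[OF k cells])
  have pair: "\<exists>a b. \<forall>c c'. c \<in> C \<and> c' \<in> C \<and> facing k d c c' \<longleftrightarrow> c = a \<and> c' = b"
    if uniq: "\<exists>!p. p \<in> {(sq k c, sq k c') | c c'. c \<in> C \<and> c' \<in> C \<and> facing k d c c'}" for d
  proof -
    obtain a b where ab: "a \<in> C" "b \<in> C" "facing k d a b" using uniq by blast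
    have "c = a \<and> c' = b" if "c \<in> C" "c' \<in> C" "facing k d c c'" for c c'
    proof -
      have "(sq k c, sq k c') = (sq k a, sq k b)" using uniq ab that by blast
      then show ?thesis by (simp add: sq_eq_iff[OF k])
    qed
    with ab show ?thesis by blast
  qed
  obtain ct cb where top: "\<And>c c'. c \<in> C \<and> c' \<in> C \<and> facing k Top c c' \<longleftrightarrow> c = ct \<and> c' = cb"
    using pair[OF vert] by blast
  obtain cl cr where left: "\<And>c c'. c \<in> C \<and> c' \<in> C \<and> facing k Left c c' \<longleftrightarrow> c = cl \<and> c' = cr"
    using pair[OF hor] by blast
  define ex where "ex d = (case d of Top \<Rightarrow> ct | Bottom \<Rightarrow> cb | Left \<Rightarrow> cl | Right \<Rightarrow> cr)" for d
  \<comment> \<open>The cases \<open>Bottom\<close> and \<open>Right\<close> are \<open>Top\<close>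
    and \<open>Left\<close> with the two cells exchanged.\<close>
  have exits: "c \<in> C \<and> c' \<in> C \<and> facing k d c c' \<longleftrightarrow> c = ex d \<and> c' = ex (opp d)" for c c' d
    using top[of c c'] top[of c' c] left[of c c'] left[of c' c]
      facing_opp[of k Top c c'] facing_opp[of k Left c c']
    by (cases d) (auto simp: ex_def simp del: facing.simps)
  have ex_in: "ex d \<in> C" and ex_facing: "facing k d (ex d) (ex (opp d))" for d
    using exits by blast+
  have "\<exists>t. itinerary C ex (start_side x) (end_side x) t" for x
  proof -
    have "\<exists>p. path_from_to (pattern_graph (sq k ` C))
        (sq k (ex (start_side x))) (sq k (ex (end_side x))) p"
      using tree ex_in by (simp add: is_tree_def)
    then obtain p where p: "path_from_to (cell_graph C) (ex (start_side x)) (ex (end_side x)) p"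
      unfolding path_from_to_sq[OF k] by blast
    \<comment> \<open>An exit lies on the border, so whatever lies across its exit side is outside
      the grid.\<close>
    have no_adj: "\<not> adj d (ex d) c" if "c \<in> set p" for c d
    proof -
      have "c \<in> {..<k} \<times> {..<k}"
        using p cells that by (auto simp: path_from_to_def is_path_def)
      then show ?thesis using facing_not_adj[OF ex_facing] by blast
    qed
    have "\<exists>t. map passed_cell t = p \<and> successively follows t \<and>
      (\<forall>s\<in>set t. entry_side s \<noteq> exit_side s) \<and> entry_side (hd t) = start_side x \<and>
      exit_side (last t) = end_side x"
    proof (rule itinerary_of_path)
      show "successively (\<lambda>u v. \<exists>d. adj d u v) p"
        using p unfolding path_from_to_def is_path_def cell_graph_edge_iff
        by (blast intro: successively_mono)
    qed (use p no_adj start_side_neq_end_side in \<open>auto simp: path_from_to_def is_path_def\<close>)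
    then obtain t where t: "map passed_cell t = p" "successively follows t"
      "\<forall>s\<in>set t. entry_side s \<noteq> exit_side s" "entry_side (hd t) = start_side x"
      "exit_side (last t) = end_side x" by blast
    have "t \<noteq> []" using t(1) p by (auto simp: path_from_to_def is_path_def)
    then have "passed_cell (hd t) = hd p" "passed_cell (last t) = last p"
      using t(1) by (auto simp: hd_map last_map)
    moreover have "passed_cell ` set t = set p" unfolding t(1)[symmetric] by simp
    ultimately have "itinerary C ex (start_side x) (end_side x) t"
      using t p \<open>t \<noteq> []\<close> by (simp add: itinerary_def path_from_to_def is_path_def)
    then show ?thesis by blast
  qed
  then have "cell_labyrinth k C ex"
    using k cells exits has_cuts_cell_graph[OF k tree] by unfold_locales auto
  with A show ?thesis by (rule that)
qed

section \<open>Composition\<close>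

lemma mixed_radix_eq_iff:
  fixes a a' b b' k :: nat
  assumes "b < k" "b' < k"
  shows "k * a + b = k * a' + b' \<longleftrightarrow> a = a' \<and> b = b'"
proof -
  have "(k * a + b) div k = a" "(k * a + b) mod k = b"
    "(k * a' + b') div k = a'" "(k * a' + b') mod k = b'"
    using assms by simp_all
  then show ?thesis by metis
qed

text \<open>The second alternative is a carry. In \<open>adj_subcell\<close> the first one becomes a
  step inside a block and the carry a step into the adjacent block.\<close>

lemma mixed_radix_Suc_iff:
  fixes a a' b b' k :: nat
  assumes "b < k" "b' < k"
  shows "Suc (k * a + b) = k * a' + b' \<longleftrightarrow>
    a = a' \<and> Suc b = b' \<or> a' = Suc a \<and> Suc b = k \<and> b' = 0"
proof (cases "Suc b = k")
  case True
  then have "Suc (k * a + b) = k * Suc a + 0" by simp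
  then show ?thesis
    using mixed_radix_eq_iff[of 0 k b' "Suc a" a'] assms True by auto
next
  case False
  then show ?thesis
    using mixed_radix_eq_iff[of "Suc b" k b' a a'] assms by auto
qed

definition subcell :: "nat \<Rightarrow> cell \<Rightarrow> cell \<Rightarrow> cell" where
  "subcell k V c = (k * fst V + fst c, k * snd V + snd c)"

definition composite :: "nat \<Rightarrow> cell set \<Rightarrow> cell set \<Rightarrow> cell set" where
  "composite k C D = {subcell k V c | V c. V \<in> C \<and> c \<in> D}"

lemma compositeE:
  assumes "a \<in> composite k C D"
  obtains V c where "V \<in> C" "c \<in> D" "a = subcell k V c"
  using assms unfolding composite_def by blast

lemma composite_mono: "X \<subseteq> Y \<Longrightarrow> composite k X D \<subseteq> composite k Y D"
  unfolding composite_def by blast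

lemma subcell_eq_iff:
  assumes "c \<in> {..<k} \<times> {..<k}" "c' \<in> {..<k} \<times> {..<k}"
  shows "subcell k V c = subcell k V' c' \<longleftrightarrow> V = V' \<and> c = c'"
  using assms by (auto simp: subcell_def mixed_radix_eq_iff prod_eq_iff mem_Times_iff)

lemma adj_subcell:
  assumes "c \<in> {..<k} \<times> {..<k}" "c' \<in> {..<k} \<times> {..<k}"
  shows "adj d (subcell k V c) (subcell k V' c') \<longleftrightarrow> V = V' \<and> adj d c c' \<or> adj d V V' \<and> facing k d c c'"
proof -
  have "fst c < k" "snd c < k" "fst c' < k" "snd c' < k"
    using assms by (auto simp: mem_Times_iff)
  note iffs = this mixed_radix_eq_iff mixed_radix_Suc_iff
    mixed_radix_Suc_iff[THEN eq_commute[THEN trans]]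
  show ?thesis
    by (cases d) (auto simp: subcell_def iffs prod_eq_iff)
qed

lemma facing_subcell:
  assumes "c \<in> {..<l} \<times> {..<l}" "c' \<in> {..<l} \<times> {..<l}"
  shows "facing (k * l) d (subcell l V c) (subcell l V' c') \<longleftrightarrow> facing k d V V' \<and> facing l d c c'"
proof -
  have l: "fst c < l" "snd c < l" "fst c' < l" "snd c' < l"
    using assms by (auto simp: mem_Times_iff)
  \<comment> \<open>The last index is reached exactly when both digits are maximal: a carry to high
    digit \<open>k\<close> and low digit 0.\<close>
  have *: "Suc (l * a + b) = k * l \<longleftrightarrow> Suc a = k \<and> Suc b = l" if "b < l" for a b
    using mixed_radix_Suc_iff[of b l 0 a k] that by (auto simp: mult.commute)
  show ?thesis
    using l by (cases d) (auto simp: subcell_def * mixed_radix_eq_iff)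
qed

section \<open>Exits and cuts of a composite\<close>

locale labyrinth_composition =
  outer: cell_labyrinth k C ex + inner: cell_labyrinth l D ey
  for k C ex l D ey
begin

lemma inner_cell: "c \<in> D \<Longrightarrow> c \<in> {..<l} \<times> {..<l}"
  using inner.cells by blast

lemma subcell_inject:
  "c \<in> D \<Longrightarrow> c' \<in> D \<Longrightarrow> subcell l V c = subcell l V' c' \<longleftrightarrow> V = V' \<and> c = c'"
  by (rule subcell_eq_iff) (simp_all only: inner_cell)

text \<open>Among white cells, only the exit pair is facing; hence two adjacent blocks are joined by
  a single edge.\<close>

lemma adj_subcell_iff:
  assumes "c \<in> D" "c' \<in> D"
  shows "adj d (subcell l V c) (subcell l V' c') \<longleftrightarrow>
    V = V' \<and> adj d c c' \<or> adj d V V' \<and> c = ey d \<and> c' = ey (opp d)"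
  using assms inner.exits[of c c' d] by (simp only: adj_subcell inner_cell) blast

lemma composite_disjoint:
  assumes "X \<inter> Y = {}"
  shows "composite l X D \<inter> composite l Y D = {}"
proof (rule Int_emptyI)
  fix a assume "a \<in> composite l X D" "a \<in> composite l Y D"
  then obtain V c V' c' where V: "V \<in> X" "c \<in> D" "V' \<in> Y" "c' \<in> D"
    and "a = subcell l V c" "a = subcell l V' c'"
    by (elim compositeE)
  then have "V = V'" using subcell_inject by simp
  then show False using V assms by blast
qed

lemma composite_cells: "composite l C D \<subseteq> {..<k * l} \<times> {..<k * l}"
proof -
  have *: "l * a + b < k * l" if "a < k" "b < l" for a b
  proof -
    have "l * a + b < l * Suc a" using that by simp
    also have "\<dots> \<le> l * k" using that by (intro mult_le_mono2) simp
    finally show ?thesis by (simp add: mult.commute)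
  qed
  show ?thesis
    using outer.cells inner.cells by (fastforce simp: composite_def subcell_def intro: *)
qed

lemma composite_exits:
  "a \<in> composite l C D \<and> b \<in> composite l C D \<and> facing (k * l) d a b \<longleftrightarrow>
    a = subcell l (ex d) (ey d) \<and> b = subcell l (ex (opp d)) (ey (opp d))"
proof
  assume "a \<in> composite l C D \<and> b \<in> composite l C D \<and> facing (k * l) d a b"
  then obtain V c V' c' where
    "V \<in> C" "c \<in> D" "V' \<in> C" "c' \<in> D" "a = subcell l V c" "b = subcell l V' c'"
    "facing (k * l) d (subcell l V c) (subcell l V' c')"
    unfolding composite_def by blast
  then show "a = subcell l (ex d) (ey d) \<and> b = subcell l (ex (opp d)) (ey (opp d))"
    using outer.exits[of V V' d] inner.exits[of c c' d] by (simp add: facing_subcell inner_cell)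
next
  assume ab: "a = subcell l (ex d) (ey d) \<and> b = subcell l (ex (opp d)) (ey (opp d))"
  have "facing (k * l) d a b"
    using ab outer.ex_facing inner.ex_facing by (simp add: facing_subcell inner_cell)
  then show "a \<in> composite l C D \<and> b \<in> composite l C D \<and> facing (k * l) d a b"
    using ab outer.ex_in inner.ex_in unfolding composite_def by blast
qed

lemma composite_edge_cases:
  assumes "V \<in> C" "c \<in> D" "V' \<in> C" "c' \<in> D"
    and "{subcell l V c, subcell l V' c'} \<in> snd (cell_graph (composite l C D))"
  obtains (inside) d where "V' = V" "adj d c c'" "{c, c'} \<in> snd (cell_graph D)"
  | (across) d where "adj d V V'" "{V, V'} \<in> snd (cell_graph C)" "c = ey d" "c' = ey (opp d)"
proof -
  obtain d where "adj d (subcell l V c) (subcell l V' c')"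
    using assms(5) unfolding cell_graph_edge_iff by blast
  then have "V = V' \<and> adj d c c' \<or> adj d V V' \<and> c = ey d \<and> c' = ey (opp d)"
    by (simp only: adj_subcell_iff[OF assms(2,4)])
  then show ?thesis
    using that assms(1-4) unfolding cell_graph_edge_iff by blast
qed

lemma composite_cuts: "has_cuts (cell_graph (composite l C D))"
  unfolding has_cuts_def
proof (intro allI impI)
  let ?E = "snd (cell_graph (composite l C D))"
  fix u v
  let ?cut = "\<exists>S. u \<notin> S \<and> v \<in> S \<and> (\<forall>a b. {a, b} \<in> ?E \<longrightarrow> a \<notin> S \<longrightarrow> b \<in> S \<longrightarrow> a = u \<and> b = v)"
  assume uv: "{u, v} \<in> ?E"
  then have "u \<in> composite l C D" "v \<in> composite l C D"
    unfolding cell_graph_edge_iff by blast+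
  then obtain V c V' c' where V: "V \<in> C" "c \<in> D" "V' \<in> C" "c' \<in> D"
    and u: "u = subcell l V c" and v: "v = subcell l V' c'"
    by (elim compositeE)
  \<comment> \<open>Cuts may be given by a predicate on pairs of block and inner cell, since such a
    pair is determined by its subcell.\<close>
  have cutI: ?cut
    if P: "\<not> P V c" "P V' c'"
      "\<And>W w W' w'. W \<in> C \<Longrightarrow> w \<in> D \<Longrightarrow> W' \<in> C \<Longrightarrow> w' \<in> D \<Longrightarrow>
        {subcell l W w, subcell l W' w'} \<in> ?E \<Longrightarrow> \<not> P W w \<Longrightarrow> P W' w' \<Longrightarrow>
        W = V \<and> w = c \<and> W' = V' \<and> w' = c'" for P
  proof -
    let ?S = "{subcell l W w | W w. w \<in> D \<and> P W w}"
    have mem: "subcell l W w \<in> ?S \<longleftrightarrow> P W w" if "w \<in> D" for W w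
    proof
      assume "subcell l W w \<in> ?S"
      then obtain W' w' where "w' \<in> D" "P W' w'" "subcell l W w = subcell l W' w'"
        by blast
      then show "P W w" using that by (simp add: subcell_inject)
    qed (use that in blast)
    have "a = u \<and> b = v" if ab: "{a, b} \<in> ?E" "a \<notin> ?S" "b \<in> ?S" for a b
    proof -
      have "a \<in> composite l C D" "b \<in> composite l C D"
        using ab(1) unfolding cell_graph_edge_iff by blast+
      then obtain W w W' w' where W: "W \<in> C" "w \<in> D" "W' \<in> C" "w' \<in> D"
        and a: "a = subcell l W w" and b: "b = subcell l W' w'"
        by (elim compositeE)
      show ?thesis
        using P(3)[OF W] ab unfolding a b u v mem[OF W(2)] mem[OF W(4)] by simp
    qed
    moreover have "u \<notin> ?S" "v \<in> ?S"
      using P(1,2) unfolding u v mem[OF V(2)] mem[OF V(4)] by simp_all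
    ultimately show ?thesis by (intro exI[of _ ?S]) blast
  qed
  from V uv[unfolded u v] show ?cut
  proof (cases rule: composite_edge_cases)
    case (across d)
    obtain S where S: "V \<notin> S" "V' \<in> S"
      "\<And>a b. {a, b} \<in> snd (cell_graph C) \<Longrightarrow> a \<notin> S \<Longrightarrow> b \<in> S \<Longrightarrow> a = V \<and> b = V'"
      using outer.cuts across(2) unfolding has_cuts_def by metis
    show ?thesis
    \<comment> \<open>Membership depends on the block alone, so a crossing edge goes from
      \<open>V\<close> to \<open>V'\<close>, and its inner cells are the exits at the common
      side.\<close>
    proof (rule cutI[of "\<lambda>W w. W \<in> S"])
      fix W w W' w'
      assume "W \<in> C" "w \<in> D" "W' \<in> C" "w' \<in> D"
        and "{subcell l W w, subcell l W' w'} \<in> ?E" and S': "W \<notin> S" "W' \<in> S"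
      then show "W = V \<and> w = c \<and> W' = V' \<and> w' = c'"
      proof (cases rule: composite_edge_cases)
        case inside
        then show ?thesis using S' by simp
      next
        case e: (across e)
        then have "W = V" "W' = V'" using S(3) S' by blast+
        then show ?thesis using e across adj_side_unique[of d V V' e] by simp
      qed
    qed (use S(1,2) in auto)
  next
    case (inside d)
    obtain S where S: "c \<notin> S" "c' \<in> S"
      "\<And>a b. {a, b} \<in> snd (cell_graph D) \<Longrightarrow> a \<notin> S \<Longrightarrow> b \<in> S \<Longrightarrow> a = c \<and> b = c'"
      using inner.cuts inside(3) unfolding has_cuts_def by metis
    \<comment> \<open>On a side where \<open>V\<close> has no outer neighbour the branch is
      empty.\<close>
    have "\<exists>B. V \<notin> B \<and> (\<forall>W\<in>C. adj d V W \<longrightarrow> W \<in> B) \<and>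
      (\<forall>a b. {a, b} \<in> snd (cell_graph C) \<longrightarrow> a \<notin> B \<longrightarrow> b \<in> B \<longrightarrow> a = V \<and> adj d V b)" for d
    proof (cases "\<exists>W\<in>C. adj d V W")
      case True
      then obtain W where W: "W \<in> C" "adj d V W" by blast
      then have "{V, W} \<in> snd (cell_graph C)"
        using V(1) unfolding cell_graph_edge_iff by blast
      then obtain B where "V \<notin> B" "W \<in> B"
        "\<And>a b. {a, b} \<in> snd (cell_graph C) \<Longrightarrow> a \<notin> B \<Longrightarrow> b \<in> B \<Longrightarrow> a = V \<and> b = W"
        using outer.cuts unfolding has_cuts_def by metis
      then show ?thesis using W adj_cell_unique by (intro exI[of _ B]) blast
    next
      case False
      then show ?thesis by (intro exI[of _ "{}"]) blast
    qed
    then obtain B where B: "\<And>d. V \<notin> B d" "\<And>d W. W \<in> C \<Longrightarrow> adj d V W \<Longrightarrow> W \<in> B d"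
      "\<And>d a b. {a, b} \<in> snd (cell_graph C) \<Longrightarrow> a \<notin> B d \<Longrightarrow> b \<in> B d \<Longrightarrow> a = V \<and> adj d V b"
      by metis
    \<comment> \<open>\<open>B d\<close> is the branch of the outer tree hanging off the side \<open>d\<close> of \<open>V\<close>; it lies on the
      same side of the cut as the inner exit that leads to it.\<close>
    define P where "P W w \<longleftrightarrow> (if W = V then w \<in> S else \<exists>d. W \<in> B d \<and> ey d \<in> S)" for W w
    show ?thesis
    proof (rule cutI[of P])
      fix W w W' w'
      assume W: "W \<in> C" "w \<in> D" "W' \<in> C" "w' \<in> D"
        and "{subcell l W w, subcell l W' w'} \<in> ?E" and P: "\<not> P W w" "P W' w'"
      from this(1-5) show "W = V \<and> w = c \<and> W' = V' \<and> w' = c'"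
      proof (cases rule: composite_edge_cases)
        case e: (inside e)
        \<comment> \<open>In any block other than \<open>V\<close> the predicate \<open>P\<close>
          ignores the inner cell, so it cannot change along an edge inside that block.\<close>
        have "W = V" by (rule ccontr) (use P e(1) in \<open>auto simp: P_def\<close>)
        then show ?thesis using P e inside S(3)[of w w'] by (simp add: P_def)
      next
        case e: (across e)
        have edge: "{W', W} \<in> snd (cell_graph C)" using e(2) by (simp only: insert_commute)
        have "W \<noteq> W'" using e(1) adj_neq by blast
        \<comment> \<open>Edges between blocks do not cross the cut. One into \<open>V\<close> comes
          from the branch at the exit it enters, which has the same value of \<open>P\<close>; one
          into a branch \<open>B d\<close> that does not start in that branch must start at the exit
          \<open>ey d\<close> of \<open>V\<close>, again with the same value.\<close>
        show ?thesis
        proof (cases "W' = V")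
          case True
          then have "W \<in> B (opp e)" using e(1) W(1) B(2) adj_opp by blast
          then have "P W w" using P(2) True e(4) \<open>W \<noteq> W'\<close> by (auto simp: P_def)
          then show ?thesis using P(1) by blast
        next
          case False
          then obtain d where d: "W' \<in> B d" "ey d \<in> S" using P(2) by (auto simp: P_def)
          have "W \<notin> B d"
            using P(1) d(2) B(1) by (auto simp: P_def split: if_splits)
          then have "W = V" "adj d V W'" using B(3)[OF e(2)] d(1) by blast+
          then have "d = e" using e(1) adj_side_unique by blast
          then have "P W w" using \<open>W = V\<close> e(3) d(2) by (simp add: P_def)
          then show ?thesis using P(1) by blast
        qed
      qed
    qed (use S(1,2) inside(1) in \<open>simp_all add: P_def\<close>)
  qed
qed

section \<open>Refinement of itineraries\<close>

definition place :: "cell \<Rightarrow> passage \<Rightarrow> passage" where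
  "place V s = (entry_side s, subcell l V (passed_cell s), exit_side s)"

definition refine :: "(side \<Rightarrow> side \<Rightarrow> passage list) \<Rightarrow> passage list \<Rightarrow> passage list" where
  "refine T t = concat (map (\<lambda>s. map (place (passed_cell s)) (T (entry_side s) (exit_side s))) t)"

lemma refine_itinerary:
  assumes T: "\<And>d e. d \<noteq> e \<Longrightarrow> itinerary D ey d e (T d e)"
    and t: "itinerary C ex d e t"
  shows "itinerary (composite l C D) (\<lambda>d. subcell l (ex d) (ey d)) d e (refine T t)"
proof -
  \<comment> \<open>The invariant refers to the first and last passage of \<open>t\<close> instead
    of \<open>ex\<close>, because a tail of an itinerary need not begin at an exit.\<close>
  have main: "refine T t \<noteq> [] \<and> distinct (map passed_cell (refine T t)) \<and>
      passed_cell ` set (refine T t) \<subseteq> composite l (passed_cell ` set t) D \<and>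
      successively follows (refine T t) \<and> (\<forall>s\<in>set (refine T t). entry_side s \<noteq> exit_side s) \<and>
      entry_side (hd (refine T t)) = entry_side (hd t) \<and>
      exit_side (last (refine T t)) = exit_side (last t) \<and>
      passed_cell (hd (refine T t)) = subcell l (passed_cell (hd t)) (ey (entry_side (hd t))) \<and>
      passed_cell (last (refine T t)) = subcell l (passed_cell (last t)) (ey (exit_side (last t)))"
    if "t \<noteq> []" "distinct (map passed_cell t)" "successively follows t"
      "\<forall>s\<in>set t. entry_side s \<noteq> exit_side s"
    using that
  proof (induction t)
    case (Cons s t)
    let ?V = "passed_cell s"
    define r where "r = T (entry_side s) (exit_side s)"
    have "itinerary D ey (entry_side s) (exit_side s) r"
      unfolding r_def by (rule T) (use Cons.prems in simp)
    then have r: "r \<noteq> []" "distinct (map passed_cell r)" "passed_cell ` set r \<subseteq> D"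
      "successively follows r" "\<forall>s\<in>set r. entry_side s \<noteq> exit_side s"
      "entry_side (hd r) = entry_side s" "exit_side (last r) = exit_side s"
      "passed_cell (hd r) = ey (entry_side s)" "passed_cell (last r) = ey (exit_side s)"
      by (simp_all add: itinerary_def)
    define b where "b = map (place ?V) r"
    have ref: "refine T (s # t) = b @ refine T t"
      by (simp add: refine_def b_def r_def)
    have "inj_on (subcell l ?V) D"
      using subcell_inject by (intro inj_onI) blast
    then have "distinct (map (subcell l ?V) (map passed_cell r))"
      using r(2,3) by (subst distinct_map) (auto intro: inj_on_subset)
    then have b_distinct: "distinct (map passed_cell b)"
      by (simp add: b_def place_def comp_def)
    have b_follows: "successively follows b"
      unfolding b_def successively_map
    proof (rule successively_mono[OF r(4)])
      fix s1 s2 assume "s1 \<in> set r" "s2 \<in> set r" "follows s1 s2"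
      moreover have "passed_cell s1 \<in> D" "passed_cell s2 \<in> D" using r(3) calculation by auto
      ultimately show "follows (place ?V s1) (place ?V s2)"
        by (simp add: follows_def place_def adj_subcell_iff)
    qed
    have b_cells: "passed_cell ` set b \<subseteq> composite l {?V} D"
    proof -
      have "passed_cell ` set b = subcell l ?V ` passed_cell ` set r"
        by (simp add: b_def place_def image_image)
      moreover have "composite l {?V} D = subcell l ?V ` D"
        unfolding composite_def by blast
      ultimately show ?thesis using r(3) by (simp only: image_mono)
    qed
    have b: "b \<noteq> []" "\<forall>s\<in>set b. entry_side s \<noteq> exit_side s"
      "entry_side (hd b) = entry_side s" "exit_side (last b) = exit_side s"
      "passed_cell (hd b) = subcell l ?V (ey (entry_side s))"
      "passed_cell (last b) = subcell l ?V (ey (exit_side s))"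
      using r by (auto simp: b_def place_def hd_map last_map)
    show ?case
    proof (cases "t = []")
      case True
      then have "refine T (s # t) = b" using ref by (simp add: refine_def)
      then show ?thesis using b b_cells b_follows b_distinct True by simp
    next
      case False
      let ?q = "refine T t"
      have IH: "?q \<noteq> []" "distinct (map passed_cell ?q)"
        "passed_cell ` set ?q \<subseteq> composite l (passed_cell ` set t) D" "successively follows ?q"
        "\<forall>s\<in>set ?q. entry_side s \<noteq> exit_side s" "entry_side (hd ?q) = entry_side (hd t)"
        "exit_side (last ?q) = exit_side (last t)"
        "passed_cell (hd ?q) = subcell l (passed_cell (hd t)) (ey (entry_side (hd t)))"
        "passed_cell (last ?q) = subcell l (passed_cell (last t)) (ey (exit_side (last t)))"
        using Cons.IH Cons.prems False by (auto simp: successively_Cons)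
      have "follows s (hd t)" using Cons.prems False by (simp add: successively_Cons)
      \<comment> \<open>The first block is left at the inner exit of some side and the next one is
        entered at the opposite inner exit; these two cells face each other.\<close>
      then have "follows (last b) (hd ?q)"
        using b IH by (simp add: follows_def adj_subcell_iff)
      then have follows: "successively follows (b @ ?q)"
        using b_follows IH(4) by (simp add: successively_append_iff)
      have "?V \<notin> passed_cell ` set t" using Cons.prems by simp
      then have "composite l {?V} D \<inter> composite l (passed_cell ` set t) D = {}"
        by (intro composite_disjoint) blast
      then have distinct: "distinct (map passed_cell (b @ ?q))"
        using b_distinct IH(2,3) b_cells by auto
      have "composite l {?V} D \<union> composite l (passed_cell ` set t) D
          \<subseteq> composite l (passed_cell ` set (s # t)) D"
        by (intro Un_least composite_mono) auto
      then have cells: "passed_cell ` set (b @ ?q) \<subseteq> composite l (passed_cell ` set (s # t)) D"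
        using b_cells IH(3) by (simp only: set_append image_Un) blast
      show ?thesis
        unfolding ref using follows distinct cells b IH False by auto
    qed
  qed simp
  have "composite l (passed_cell ` set t) D \<subseteq> composite l C D"
    using t unfolding itinerary_def by (intro composite_mono) blast
  then show ?thesis
    using t main unfolding itinerary_def by auto
qed

text \<open>Each outer passage of type \<open>x\<close> contributes \<open>N x\<close> passages of
  type \<open>y\<close>. Grouping the outer passages by type gives an entry of the matrix
  product.\<close>

lemma count_type_refine:
  assumes T: "\<And>d e x. d \<noteq> e \<Longrightarrow> {d, e} = {start_side x, end_side x} \<Longrightarrow> count_type y (T d e) = N x"
    and t: "\<forall>s\<in>set t. entry_side s \<noteq> exit_side s"
  shows "count_type y (refine T t) = (\<Sum>x\<in>UNIV. count_type x t * N x)"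
  using t
proof (induction t)
  case (Cons s t)
  have neq: "entry_side s \<noteq> exit_side s" using Cons.prems by simp
  obtain z where z: "\<And>x. has_type x s \<longleftrightarrow> x = z"
    using has_type_iff[OF neq] by blast
  have "has_type y \<circ> place V = has_type y" for V
    by (auto simp: has_type_def place_def)
  then have "count_type y (refine T (s # t)) =
      count_type y (T (entry_side s) (exit_side s)) + count_type y (refine T t)"
    by (simp add: refine_def count_type_def filter_map)
  also have "count_type y (T (entry_side s) (exit_side s)) = N z"
    using T[OF neq] z[of z] by (simp add: has_type_def)
  also have "count_type y (refine T t) = (\<Sum>x\<in>UNIV. count_type x t * N x)"
    using Cons by simp
  also have "N z + \<dots> = (\<Sum>x\<in>UNIV. (if x = z then N x else 0) + count_type x t * N x)"
    by (simp add: sum.distrib)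
  also have "\<dots> = (\<Sum>x\<in>UNIV. count_type x (s # t) * N x)"
    by (rule sum.cong) (simp_all add: count_type_def z)
  finally show ?case .
qed (simp add: refine_def count_type_def)

lemma inner_itineraries:
  "\<exists>T. \<forall>d e. d \<noteq> e \<longrightarrow> itinerary D ey d e (T d e) \<and>
    (\<forall>x y. {d, e} = {start_side x, end_side x} \<longrightarrow>
      count_type y (T d e) = count_squares l (sq l ` D) x y)"
proof -
  have "\<forall>d e. \<exists>t. d \<noteq> e \<longrightarrow> itinerary D ey d e t \<and>
    (\<forall>x y. {d, e} = {start_side x, end_side x} \<longrightarrow> count_type y t = count_squares l (sq l ` D) x y)"
    using inner.itinerary_between by blast
  then show ?thesis
    unfolding choice_iff .
qed

lemma cell_labyrinth_composite:
  "cell_labyrinth (k * l) (composite l C D) (\<lambda>d. subcell l (ex d) (ey d))"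
proof
  show "0 < k * l" using outer.width_pos inner.width_pos by simp
  show "\<exists>t. itinerary (composite l C D) (\<lambda>d. subcell l (ex d) (ey d)) (start_side x) (end_side x) t" for x
  proof -
    obtain T where "\<And>d e. d \<noteq> e \<Longrightarrow> itinerary D ey d e (T d e)"
      using inner_itineraries by blast
    then show ?thesis
      using refine_itinerary outer.itinerary_ex by blast
  qed
qed (rule composite_cells composite_exits composite_cuts)+

lemma count_squares_composite:
  "count_squares (k * l) (sq (k * l) ` composite l C D) x y =
    (\<Sum>z\<in>UNIV. count_squares k (sq k ` C) x z * count_squares l (sq l ` D) z y)"
proof -
  obtain T where T: "\<And>d e. d \<noteq> e \<Longrightarrow> itinerary D ey d e (T d e)"
    "\<And>d e x y. d \<noteq> e \<Longrightarrow> {d, e} = {start_side x, end_side x} \<Longrightarrow>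
      count_type y (T d e) = count_squares l (sq l ` D) x y"
    using inner_itineraries by blast
  obtain t where t: "itinerary C ex (start_side x) (end_side x) t"
    using outer.itinerary_ex by blast
  have "count_squares (k * l) (sq (k * l) ` composite l C D) x y = count_type y (refine T t)"
    by (rule cell_labyrinth.count_squares_itinerary[OF cell_labyrinth_composite
          refine_itinerary[OF T(1) t]])
  also have "\<dots> = (\<Sum>z\<in>UNIV. count_type z t * count_squares l (sq l ` D) z y)"
    by (rule count_type_refine) (use T(2) t in \<open>auto simp: itinerary_def\<close>)
  finally show ?thesis
    by (simp add: outer.count_squares_itinerary[OF t])
qed

end

section \<open>Labyrinth sets\<close>

lemma rescale_sq:
  assumes "0 < k" "0 < l"
  shows "rescale (real (fst V) / real k) (real (snd V) / real k) (1 / real k) ` sq l c =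
    sq (k * l) (subcell l V c)"
proof -
  have "rescale x y q ` (S \<times> T) = (\<lambda>z. q * z + x) ` S \<times> (\<lambda>z. q * z + y) ` T" for x y q S T
    by (auto simp: rescale_def image_def)
  moreover have "(\<lambda>z. 1 / real k * z + real a / real k) ` {real b / real l .. real (Suc b) / real l} =
      {real (l * a + b) / real (k * l) .. real (Suc (l * a + b)) / real (k * l)}" for a b
  proof -
    \<comment> \<open>The instance at \<open>Suc b\<close> yields the upper end of the
      interval.\<close>
    have "1 / real k * (real b / real l) + real a / real k = real (l * a + b) / real (k * l)" for b
      using assms by (simp add: field_simps)
    from this[of b] this[of "Suc b"] show ?thesis
      unfolding image_affinity_atLeastAtMost
      using assms by (simp add: divide_right_mono del: times_divide_eq_left)
  qed
  ultimately show ?thesis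
    unfolding sq_box subcell_def fst_conv snd_conv by (simp only:)
qed

lemma labyrinth_set_composite:
  assumes "labyrinth_set A (Suc n) = sq k ` C" "A (Suc (Suc n)) = sq l ` D" "0 < k" "0 < l"
  shows "labyrinth_set A (Suc (Suc n)) = sq (k * l) ` composite l C D"
proof -
  \<comment> \<open>The parameters bound in \<open>labyrinth_set\<close> are determined by the cell
    \<open>V\<close>, so they can be eliminated.\<close>
  have box: "0 < q \<and> {x..x + q} \<times> {y..y + q} = sq k V \<longleftrightarrow>
      x = real (fst V) / real k \<and> y = real (snd V) / real k \<and> q = 1 / real k" for x y q V
    using assms(3)
    by (auto simp: sq_box times_eq_iff Icc_eq_Icc add_divide_distrib)
  have "labyrinth_set A (Suc (Suc n)) =
      {rescale x y q ` sq l c | x y q V c. c \<in> D \<and> V \<in> C \<and> 0 < q \<and> {x..x + q} \<times> {y..y + q} = sq k V}"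
    unfolding labyrinth_set.simps assms(1,2) by blast
  also have "\<dots> = {rescale (real (fst V) / real k) (real (snd V) / real k) (1 / real k) ` sq l c | V c.
      V \<in> C \<and> c \<in> D}"
    unfolding box by blast
  also have "\<dots> = sq (k * l) ` composite l C D"
    unfolding rescale_sq[OF assms(3,4)] composite_def by blast
  finally show ?thesis .
qed

theorem proposition1:
  fixes m :: "nat \<Rightarrow> nat" and A :: "nat \<Rightarrow> square set"
  assumes "\<And>k. 1 \<le> k \<Longrightarrow> labyrinth_pattern (m k) (A k)"
  shows "\<exists>M :: nat \<Rightarrow> real ^ path_type ^ path_type.
    (\<forall>k\<ge>1. \<forall>x y. 0 \<le> M k $ x $ y) \<and>
    (\<forall>k\<ge>1. (\<chi> x. real (path_length (m k) (A k) x)) = M k *v (\<chi> y. 1)) \<and>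
    (\<forall>n\<ge>1. \<forall>x y. matrix_prod M n $ x $ y =
       real (count_squares (\<Prod>k=1..n. m k) (labyrinth_set A n) x y)) \<and>
    (\<forall>n\<ge>1. (\<chi> x. real (path_length (\<Prod>k=1..n. m k) (labyrinth_set A n) x)) =
       matrix_prod M n *v (\<chi> y. 1))"
proof -
  define M :: "nat \<Rightarrow> real ^ path_type ^ path_type"
    where "M k = (\<chi> x y. real (count_squares (m k) (A k) x y))" for k
  define w where "w n = (\<Prod>k=1..n. m k)" for n
  have step: "\<exists>C ex. A k = sq (m k) ` C \<and> cell_labyrinth (m k) C ex" if "1 \<le> k" for k
    by (rule labyrinth_pattern_cells[OF assms[OF that]]) blast
  \<comment> \<open>Besides the matrix identity, the induction carries a cell description of the
    set, without which the next composition could not be formed.\<close>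
  have main: "(\<exists>C ex. labyrinth_set A n = sq (w n) ` C \<and> cell_labyrinth (w n) C ex) \<and>
      (\<forall>x y. matrix_prod M n $ x $ y = real (count_squares (w n) (labyrinth_set A n) x y))"
    if "1 \<le> n" for n
    using that
  proof (induction n rule: nat_induct_at_least)
    case base
    then show ?case using step[of 1] by (simp add: w_def M_def)
  next
    case (Suc n)
    \<comment> \<open>The recursive equation of \<open>labyrinth_set\<close> applies from index 2
      on.\<close>
    then obtain i where n: "n = Suc i" by (cases n) auto
    obtain C ex where C: "labyrinth_set A n = sq (w n) ` C" "cell_labyrinth (w n) C ex"
      using Suc.IH by blast
    obtain D ey where D: "A (Suc n) = sq (m (Suc n)) ` D" "cell_labyrinth (m (Suc n)) D ey"
      using step[of "Suc n"] by auto
    interpret labyrinth_composition "w n" C ex "m (Suc n)" D ey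
      unfolding labyrinth_composition_def using C(2) D(2) ..
    have w: "w (Suc n) = w n * m (Suc n)"
      by (simp add: w_def)
    have set: "labyrinth_set A (Suc n) = sq (w (Suc n)) ` composite (m (Suc n)) C D"
      unfolding w using labyrinth_set_composite C(1) D(1) outer.width_pos inner.width_pos
      unfolding n by blast
    have IH: "matrix_prod M n $ x $ y = real (count_squares (w n) (sq (w n) ` C) x y)" for x y
      using Suc.IH C(1) by simp
    have "matrix_prod M (Suc n) $ x $ y =
        real (count_squares (w (Suc n)) (labyrinth_set A (Suc n)) x y)" for x y
      unfolding set w count_squares_composite
      by (simp add: matrix_matrix_mult_def IH) (simp add: M_def D(1))
    moreover have "cell_labyrinth (w (Suc n)) (composite (m (Suc n)) C D)
        (\<lambda>d. subcell (m (Suc n)) (ex d) (ey d))"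
      unfolding w by (rule cell_labyrinth_composite)
    ultimately show ?case using set by blast
  qed
  \<comment> \<open>The all-ones vector sums a row over the types, and every square of an exit path
    has exactly one type. The matrix \<open>N\<close> is kept general to serve both
    \<open>M k\<close> and the products.\<close>
  have length: "(\<chi> x. real (path_length k (sq k ` C) x)) = N *v (\<chi> y. 1)"
    if "cell_labyrinth k C ex" "\<And>x y. N $ x $ y = real (count_squares k (sq k ` C) x y)"
    for k C ex and N :: "real ^ path_type ^ path_type"
    by (simp add: vec_eq_iff matrix_vector_mult_def that(2)
        cell_labyrinth.path_length_eq_sum[OF that(1)])
  have "(\<chi> x. real (path_length (m k) (A k) x)) = M k *v (\<chi> y. 1)" if "1 \<le> k" for k
    using step[OF that] length[of "m k" _ _ "M k"] by (auto simp: M_def)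
  moreover have "(\<chi> x. real (path_length (w n) (labyrinth_set A n) x)) = matrix_prod M n *v (\<chi> y. 1)"
    if "1 \<le> n" for n
    using main[OF that] length[of "w n" _ _ "matrix_prod M n"] by auto
  ultimately show ?thesis
    using main unfolding w_def by (intro exI[of _ M]) (simp add: M_def)
qed

end
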